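(* Let $A_1,\dots,A_m\in\mathbb{S}^n$ satisfy $\operatorname{tr}A_i=0$ and $\operatorname{tr}(A_iA_j)=\delta_{ij}$ for all $i,j=1,\dots,m$. Let $\mathbf{b}\in\operatorname{int}\mathscr{M}$, let $\delta:=\operatorname{dist}(\mathbf{b},\partial\mathscr{M})>0$, let $f(\mathbf{y})=\log\operatorname{tr}\exp A(\mathbf{y})-\mathbf{b}^T\mathbf{y}$, let $\mathbf{y}^*$ be the unique minimizer of $f$ over $\mathbb{R}^m$, and let $X^*=\exp A(\mathbf{y}^* )/\operatorname{tr}\exp A(\mathbf{y}^* )$. Then: (i) $0\le f(\mathbf{y}^* )=-\operatorname{tr}(X^*\log X^* )\le\log n$, with $f(\mathbf{y}^* )=\log n$ if and only if $\mathbf{b}=0$; (ii) $\displaystyle\|\mathbf{y}^*\|_2\le\frac{f(\mathbf{y}^* )}{\delta}\le\frac{\log n}{\delta}$.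
   Context: $\mathbb{S}^n$ is the space of real symmetric $n\times n$ matrices, and $\mathbb{S}^n_1=\{X\in\mathbb{S}^n: X\succeq 0,\ \operatorname{tr}X=1\}$. $\delta_{ij}$ equals $1$ if $i=j$ and $0$ otherwise. $A(\mathbf{y})=\sum_{i=1}^m y_iA_i$, $\mathcal{A}(X)=(\operatorname{tr}(A_iX))_{i=1,\dots,m}$, and the moment body is $\mathscr{M}=\mathcal{A}(\mathbb{S}^n_1)\subset\mathbb{R}^m$, with boundary $\partial\mathscr{M}$ and interior $\operatorname{int}\mathscr{M}$ in $\mathbb{R}^m$; distances are Euclidean. For $\mathbf{b}\in\operatorname{int}\mathscr{M}$, $\delta$ is the radius of the largest Euclidean ball centered at $\mathbf{b}$ contained in $\mathscr{M}$, equivalently $\delta=\min_{\|\mathbf{v}\|_2=1}(\lambda_{\max}(A(\mathbf{v}))-\mathbf{b}^T\mathbf{v})$. Under these hypotheses $f$ has a unique global minimizer. *)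

theory Defs
  imports "HOL-Analysis.Analysis"
begin

definition symmetric_mat :: "real^'n^'n \<Rightarrow> bool" where
  "symmetric_mat X \<longleftrightarrow> transpose X = X"

definition psd_mat :: "real^'n^'n \<Rightarrow> bool" where
  "psd_mat X \<longleftrightarrow> symmetric_mat X \<and> (\<forall>v. 0 \<le> v \<bullet> (X *v v))"

definition spectraplex :: "(real^'n^'n) set" where
  "spectraplex = {X. psd_mat X \<and> trace X = 1}"

text \<open>On \<^typ>\<open>real^'n^'n\<close> the library's \<open>*\<close> and \<open>^\<close> act componentwise, so the power
  series of the exponential is written out with the matrix product.\<close>

primrec mat_pow :: "real^'n^'n \<Rightarrow> nat \<Rightarrow> real^'n^'n" where
  "mat_pow X 0 = mat 1"
| "mat_pow X (Suc k) = X ** mat_pow X k"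

definition mat_exp :: "real^'n^'n \<Rightarrow> real^'n^'n" where
  "mat_exp X = (\<Sum>k. mat_pow X k /\<^sub>R fact k)"

text \<open>The real logarithm of a symmetric positive definite matrix: the inverse of the bijection
  \<^const>\<open>mat_exp\<close> from the symmetric matrices onto the symmetric positive definite ones.
  Restricting to symmetric \<open>L\<close> is what makes the logarithm unique; the value is unspecified
  if \<open>X\<close> is not symmetric positive definite.\<close>

definition mat_log :: "real^'n^'n \<Rightarrow> real^'n^'n" where
  "mat_log X = (THE L. symmetric_mat L \<and> mat_exp L = X)"

definition lin_comb :: "('m::finite \<Rightarrow> real^'n^'n) \<Rightarrow> real^'m \<Rightarrow> real^'n^'n" where
  "lin_comb A y = (\<Sum>i\<in>UNIV. (y $ i) *\<^sub>R A i)"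

definition moment_map :: "('m::finite \<Rightarrow> real^'n^'n) \<Rightarrow> real^'n^'n \<Rightarrow> real^'m" where
  "moment_map A X = (\<chi> i. trace (A i ** X))"

definition moment_body :: "('m::finite \<Rightarrow> real^'n^'n) \<Rightarrow> (real^'m) set" where
  "moment_body A = moment_map A ` spectraplex"

definition dual_fun :: "('m::finite \<Rightarrow> real^'n^'n) \<Rightarrow> real^'m \<Rightarrow> real^'m \<Rightarrow> real" where
  "dual_fun A b y = ln (trace (mat_exp (lin_comb A y))) - b \<bullet> y"

definition gibbs_state :: "('m::finite \<Rightarrow> real^'n^'n) \<Rightarrow> real^'m \<Rightarrow> real^'n^'n" where
  "gibbs_state A y = mat_exp (lin_comb A y) /\<^sub>R trace (mat_exp (lin_comb A y))"

end

theory Submission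
  imports Defs
begin

text \<open>
  Write \<open>H = A(y)\<close> and \<open>Z = tr (exp H)\<close>. Everything about \<open>H\<close> can be read off an orthonormal
  eigenbasis \<open>B\<close> with eigenvalues \<open>l v\<close>: the exponential, the logarithm and all traces become
  sums over \<open>B\<close>, with \<open>Z = (\<Sum>v\<in>B. exp (l v))\<close>. The spectral theorem
  (\<open>symmetric_mat_spectral\<close>) is therefore proved first, by maximising the Rayleigh quotient on
  invariant subspaces.

  The norm bound comes from linear growth of the objective. For every density matrix \<open>X\<close> one has
  \<open>tr (H X) \<le> ln Z\<close> (\<open>trace_mult_le_ln_trace_exp\<close>), because the left side is a weighted mean
  of eigenvalues and \<open>exp (l v) \<le> Z\<close>. The moment body is compact, so it contains the closed ball
  of radius \<open>\<delta>\<close> around \<open>b\<close>; choosing \<open>X\<close> with moments \<open>b + \<delta> y / \<parallel>y\<parallel>\<close>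
  turns the inequality into \<open>\<delta> \<parallel>y\<parallel> \<le> f(y)\<close> (\<open>norm_le_dual_fun\<close>). This also
  gives \<open>f \<ge> 0\<close>, and \<open>f(0) = ln n\<close> gives the upper bound for the minimum.

  The two remaining claims are first-order conditions, and in both only the derivative of \<open>f\<close>
  along a line through the origin is involved (\<open>dual_fun_stationary_on_ray\<close>). On such a line the
  matrices \<open>A(t u) = t A(u)\<close> commute, so \<open>f(t u) = ln (\<Sum>v\<in>B. exp (t * l v)) - t (b \<bullet> u)\<close> is
  differentiated as a scalar function. The line through \<open>y*\<close> at \<open>t = 1\<close> yields
  \<open>b \<bullet> y* = tr (X* A(y*))\<close>, and since \<open>log X* = A(y*) - (ln Z) I\<close> the minimum is the
  entropy of \<open>X*\<close>. If the minimum is \<open>ln n\<close>, then \<open>0\<close> is a minimiser as well, and the line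
  through \<open>b\<close> at \<open>t = 0\<close> yields \<open>n (b \<bullet> b) = tr A(b) = 0\<close>. Conversely, if \<open>b = 0\<close>, then
  \<open>exp x \<ge> 1 + x\<close> and \<open>tr A(y) = 0\<close> give \<open>Z \<ge> n\<close>.
\<close>

section \<open>The spectral theorem for real symmetric matrices\<close>

lemma symmetric_mat_entry:
  assumes "symmetric_mat X"
  shows "X $ i $ j = X $ j $ i"
proof -
  have "transpose X $ i $ j = X $ i $ j"
    using assms by (simp add: symmetric_mat_def)
  then show ?thesis by (simp add: transpose_def)
qed

lemma symmetric_mat_inner:
  assumes "symmetric_mat H"
  shows "(H *v x) \<bullet> y = x \<bullet> (H *v y)"
  by (metis assms dot_lmul_matrix symmetric_mat_def transpose_matrix_vector)

text \<open>A maximiser \<open>v\<close> of the Rayleigh quotient on the unit sphere of \<open>S\<close> is an eigenvector: the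
  residual \<open>w = H v - c v\<close> lies in \<open>S\<close> again, and perturbing \<open>v\<close> in the direction \<open>w\<close> would
  increase the quotient to first order unless \<open>w = 0\<close>.\<close>

lemma symmetric_mat_eigenvector_in_subspace:
  fixes H :: "real^'n^'n"
  assumes sym: "symmetric_mat H" and S: "subspace S" and inv: "\<And>x. x \<in> S \<Longrightarrow> H *v x \<in> S"
    and nontriv: "S \<noteq> {0}"
  obtains v c where "v \<in> S" "norm v = 1" "H *v v = c *\<^sub>R v"
proof -
  obtain s where s: "s \<in> S" "s \<noteq> 0"
    using nontriv subspace_0[OF S] by blast
  define K where "K = S \<inter> sphere 0 1"
  have "compact K"
    unfolding K_def using closed_subspace[OF S] compact_sphere by (metis closed_Int_compact)
  moreover have "s /\<^sub>R norm s \<in> K"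
    using s S by (simp add: K_def subspace_scale)
  moreover have "continuous_on K (\<lambda>x. x \<bullet> (H *v x))"
    by (intro continuous_intros linear_continuous_on_compose[OF continuous_on_id]) auto
  ultimately obtain v where v: "v \<in> K" and max: "\<And>x. x \<in> K \<Longrightarrow> x \<bullet> (H *v x) \<le> v \<bullet> (H *v v)"
    using continuous_attains_sup[of K "\<lambda>x. x \<bullet> (H *v x)"] by blast
  define c where "c = v \<bullet> (H *v v)"
  have vS: "v \<in> S" and nv: "norm v = 1" "v \<bullet> v = 1"
    using v by (auto simp: K_def dot_square_norm)
  have quad: "x \<bullet> (H *v x) \<le> c * (x \<bullet> x)" if "x \<in> S" for x
  proof (cases "x = 0")
    case False
    then have "x /\<^sub>R norm x \<in> K"
      using that S by (simp add: K_def subspace_scale)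
    from max[OF this] have "(x \<bullet> (H *v x)) / (norm x)\<^sup>2 \<le> c"
      using False by (simp add: c_def matrix_vector_mult_scaleR divide_inverse power2_eq_square mult_ac)
    then show ?thesis
      using False by (simp add: divide_le_eq dot_square_norm)
  qed simp
  define w where "w = H *v v - c *\<^sub>R v"
  have wS: "w \<in> S"
    unfolding w_def using S inv vS by (simp add: subspace_diff subspace_scale)
  \<comment> \<open>By the quadratic bound, \<open>g\<close> is nonnegative and vanishes at \<open>0\<close>, so its derivative
    there, which is a multiple of \<open>w \<bullet> w\<close>, must be zero.\<close>
  define g where "g t = c * ((v + t *\<^sub>R w) \<bullet> (v + t *\<^sub>R w)) - (v + t *\<^sub>R w) \<bullet> (H *v (v + t *\<^sub>R w))" for t
  have g_eq: "g t = t * (- 2 * (w \<bullet> w)) + t\<^sup>2 * (c * (w \<bullet> w) - w \<bullet> (H *v w))" for t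
  proof -
    have 1: "w \<bullet> (H *v v) = w \<bullet> w + c * (v \<bullet> w)"
      by (subst (2) w_def) (simp add: inner_diff_right inner_commute)
    have 2: "v \<bullet> (H *v w) = w \<bullet> w + c * (v \<bullet> w)"
      using symmetric_mat_inner[OF sym, of v w] 1 by (simp add: inner_commute)
    show ?thesis
      unfolding g_def matrix_vector_right_distrib matrix_vector_mult_scaleR inner_add_left
        inner_add_right inner_scaleR_left inner_scaleR_right 1 2 c_def[symmetric] nv
      by (simp add: inner_commute[of w v] algebra_simps power2_eq_square)
  qed
  have "(g has_real_derivative - 2 * (w \<bullet> w)) (at 0)"
    unfolding g_eq[abs_def] by (auto intro!: derivative_eq_intros)
  moreover have "g 0 \<le> g t" for t
    using quad[of "v + t *\<^sub>R w"] S vS wS g_eq[of 0] by (simp add: g_def subspace_add subspace_scale)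
  ultimately have "- 2 * (w \<bullet> w) = 0"
    by (intro DERIV_local_min[of g _ 0 1]) auto
  then have "H *v v = c *\<^sub>R v"
    by (simp add: w_def)
  with vS nv that show thesis by blast
qed

text \<open>The orthogonal complement of an eigenvector inside an invariant subspace is again invariant,
  since \<open>v \<bullet> H x = H v \<bullet> x = c (v \<bullet> x)\<close>, and has smaller dimension.\<close>

lemma orthonormal_eigenvectors_of_subspace:
  fixes H :: "real^'n^'n"
  assumes sym: "symmetric_mat H" and "subspace S" and "\<And>x. x \<in> S \<Longrightarrow> H *v x \<in> S"
  shows "\<exists>B \<subseteq> S. pairwise orthogonal B \<and> (\<forall>v\<in>B. norm v = 1 \<and> (\<exists>c. H *v v = c *\<^sub>R v)) \<and> S \<subseteq> span B"
  using assms(2,3)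
proof (induction "dim S" arbitrary: S rule: less_induct)
  case less
  show ?case
  proof (cases "S = {0}")
    case True
    then show ?thesis by (intro exI[of _ "{}"]) auto
  next
    case False
    then obtain v c where v: "v \<in> S" "norm v = 1" "H *v v = c *\<^sub>R v"
      using symmetric_mat_eigenvector_in_subspace[OF sym less.prems] by metis
    have vv: "v \<bullet> v = 1" using v by (simp add: dot_square_norm)
    define T where "T = {x \<in> S. v \<bullet> x = 0}"
    have T: "subspace T"
      using less.prems(1) by (auto simp: T_def subspace_def inner_add_right)
    have "T \<subset> S"
    proof
      show "T \<subseteq> S" by (auto simp: T_def)
      have "v \<notin> T" using vv by (simp add: T_def)
      then show "T \<noteq> S" using v(1) by blast
    qed
    then have "dim T < dim S"
      using T less.prems(1) by (metis dim_psubset span_eq_iff)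
    moreover have "H *v x \<in> T" if "x \<in> T" for x
      using that less.prems(2) symmetric_mat_inner[OF sym, of v x] v(3) by (auto simp: T_def)
    ultimately obtain B where B: "B \<subseteq> T" "pairwise orthogonal B"
      "\<forall>u\<in>B. norm u = 1 \<and> (\<exists>c. H *v u = c *\<^sub>R u)" "T \<subseteq> span B"
      using less.hyps[of T] T by blast
    have "S \<subseteq> span (insert v B)"
    proof
      fix x assume "x \<in> S"
      then have "x - (v \<bullet> x) *\<^sub>R v \<in> T"
        using v(1) vv less.prems(1)
        by (simp add: T_def subspace_diff subspace_scale inner_diff_right)
      then show "x \<in> span (insert v B)"
        using B(4) span_breakdown_eq by blast
    qed
    moreover have "pairwise orthogonal (insert v B)"
      using B(1,2) by (auto simp: pairwise_insert T_def orthogonal_def inner_commute)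
    ultimately show ?thesis
      using B(1,3) v by (intro exI[of _ "insert v B"]) (auto simp: T_def)
  qed
qed

definition orthonormal_basis :: "(real^'n) set \<Rightarrow> bool" where
  "orthonormal_basis B \<longleftrightarrow> pairwise orthogonal B \<and> (\<forall>v\<in>B. norm v = 1) \<and> span B = UNIV"

lemma orthonormal_basis_finite: "orthonormal_basis B \<Longrightarrow> finite B"
  unfolding orthonormal_basis_def
  by (metis norm_zero pairwise_orthogonal_independent independent_imp_finite zero_neq_one)

lemma orthonormal_basis_nonempty: "orthonormal_basis B \<Longrightarrow> B \<noteq> {}"
proof
  assume "orthonormal_basis B" "B = {}"
  then have "axis undefined 1 \<in> {0 :: real^'n}" by (auto simp: orthonormal_basis_def)
  then show False by simp
qed

lemma orthonormal_basis_inner: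
  assumes "orthonormal_basis B" "u \<in> B" "v \<in> B"
  shows "u \<bullet> v = (if u = v then 1 else 0)"
  using assms by (auto simp: orthonormal_basis_def pairwise_def orthogonal_def dot_square_norm)

lemma orthonormal_basis_expansion:
  assumes "orthonormal_basis B"
  shows "(\<Sum>v\<in>B. (x \<bullet> v) *\<^sub>R v) = x"
  using assms orthonormal_basis_finite[OF assms]
  by (intro orthonormal_basis_expand) (auto simp: orthonormal_basis_def)

definition rank_one_mat :: "real^'n \<Rightarrow> real^'n^'n" where
  "rank_one_mat v = (\<chi> i j. v $ i * v $ j)"

text \<open>For an orthonormal basis \<open>B\<close> this is the matrix with eigenvectors \<open>B\<close> and eigenvalues \<open>g\<close>;
  for fixed \<open>B\<close> it is the functional calculus of matrices diagonal in \<open>B\<close>. Eigenvalues are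
  indexed by the basis vectors themselves, so that no enumeration of \<open>B\<close> is needed.\<close>

definition spectral_sum :: "(real^'n) set \<Rightarrow> (real^'n \<Rightarrow> real) \<Rightarrow> real^'n^'n" where
  "spectral_sum B g = (\<Sum>v\<in>B. g v *\<^sub>R rank_one_mat v)"

lemma rank_one_mat_vector_mult: "rank_one_mat v *v x = (v \<bullet> x) *\<^sub>R v"
  by (simp add: rank_one_mat_def matrix_vector_mult_def vec_eq_iff inner_vec_def sum_distrib_left
      mult_ac)

lemma spectral_sum_vector_mult: "spectral_sum B g *v x = (\<Sum>v\<in>B. (g v * (v \<bullet> x)) *\<^sub>R v)"
proof -
  have "(\<Sum>v\<in>B. M v) *v x = (\<Sum>v\<in>B. M v *v x)" for M :: "real^'a \<Rightarrow> real^'a^'a"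
    by (induction B rule: infinite_finite_induct) (auto simp: matrix_vector_mult_add_rdistrib)
  then show ?thesis
    by (simp add: spectral_sum_def rank_one_mat_vector_mult scaleR_matrix_vector_assoc[symmetric])
qed

lemma spectral_sum_eigenvector:
  assumes "orthonormal_basis B" "v \<in> B"
  shows "spectral_sum B g *v v = g v *\<^sub>R v"
proof -
  have "spectral_sum B g *v v = (\<Sum>u\<in>B. if u = v then g v *\<^sub>R v else 0)"
    unfolding spectral_sum_vector_mult
    using assms by (intro sum.cong) (auto simp: orthonormal_basis_inner)
  then show ?thesis
    using assms orthonormal_basis_finite[OF assms(1)] by (simp add: sum.delta)
qed

lemma matrix_eq_on_orthonormal_basis:
  fixes M N :: "real^'n^'n"
  assumes "orthonormal_basis B" "\<And>v. v \<in> B \<Longrightarrow> M *v v = N *v v"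
  shows "M = N"
proof -
  have "M *v x = N *v x" for x
    using assms linear_eq_on_span[of "(*v) M" "(*v) N" B x] by (auto simp: orthonormal_basis_def)
  then show ?thesis by (simp add: matrix_eq)
qed

lemma spectral_sum_mult:
  assumes "orthonormal_basis B"
  shows "spectral_sum B g ** spectral_sum B h = spectral_sum B (\<lambda>v. g v * h v)"
  using assms
  by (intro matrix_eq_on_orthonormal_basis[OF assms])
    (simp add: matrix_vector_mul_assoc[symmetric] spectral_sum_eigenvector
      matrix_vector_mult_scaleR mult.commute)

lemma spectral_sum_one: "orthonormal_basis B \<Longrightarrow> spectral_sum B (\<lambda>_. 1) = mat 1"
  by (rule matrix_eq_on_orthonormal_basis) (auto simp: spectral_sum_eigenvector)

lemma spectral_sum_scaleR: "c *\<^sub>R spectral_sum B g = spectral_sum B (\<lambda>v. c * g v)"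
  by (simp add: spectral_sum_def scaleR_sum_right)

theorem symmetric_mat_spectral:
  fixes H :: "real^'n^'n"
  assumes "symmetric_mat H"
  obtains B l where "orthonormal_basis B" "H = spectral_sum B l"
proof -
  obtain B where B: "pairwise orthogonal B" "\<forall>v\<in>B. norm v = 1 \<and> (\<exists>c. H *v v = c *\<^sub>R v)"
      "UNIV \<subseteq> span B"
    using orthonormal_eigenvectors_of_subspace[OF assms subspace_UNIV] by auto
  then obtain l where l: "\<And>v. v \<in> B \<Longrightarrow> H *v v = l v *\<^sub>R v" by metis
  have "orthonormal_basis B" using B by (auto simp: orthonormal_basis_def)
  moreover from this have "H = spectral_sum B l"
    by (rule matrix_eq_on_orthonormal_basis) (simp add: l spectral_sum_eigenvector calculation)
  ultimately show thesis by (rule that)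
qed

section \<open>Traces, exponentials and logarithms in an eigenbasis\<close>

lemma symmetric_spectral_sum: "symmetric_mat (spectral_sum B g)"
  by (simp add: symmetric_mat_def spectral_sum_def transpose_def rank_one_mat_def vec_eq_iff mult.commute)

lemma linear_trace_mult: "linear (\<lambda>Y :: real^'n^'n. trace (X ** Y))"
  by (rule linearI)
    (simp_all add: matrix_add_ldistrib trace_add trace_def matrix_matrix_mult_def sum.distrib
      sum_distrib_left algebra_simps)

lemma trace_mult_rank_one: "trace (X ** rank_one_mat v) = v \<bullet> (X *v v)"
  by (simp add: trace_def matrix_matrix_mult_def rank_one_mat_def inner_vec_def
      matrix_vector_mult_def sum_distrib_left mult_ac)

lemma trace_mult_spectral_sum:
  "trace (X ** spectral_sum B g) = (\<Sum>v\<in>B. g v * (v \<bullet> (X *v v)))"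
  unfolding spectral_sum_def
  by (simp add: linear_sum[OF linear_trace_mult] linear_cmul[OF linear_trace_mult] trace_mult_rank_one)

lemma trace_spectral_sum:
  assumes "orthonormal_basis B"
  shows "trace (spectral_sum B g) = (\<Sum>v\<in>B. g v)"
  using trace_mult_spectral_sum[of "mat 1" B g] assms
  by (simp add: orthonormal_basis_inner)

lemma mat_pow_spectral_sum:
  assumes "orthonormal_basis B"
  shows "mat_pow (spectral_sum B g) k = spectral_sum B (\<lambda>v. g v ^ k)"
  by (induction k) (simp_all add: assms spectral_sum_one spectral_sum_mult)

lemma mat_exp_spectral_sum:
  assumes "orthonormal_basis B"
  shows "mat_exp (spectral_sum B g) = spectral_sum B (\<lambda>v. exp (g v))"
proof -
  have "(\<lambda>k. \<Sum>v\<in>B. (g v ^ k /\<^sub>R fact k) *\<^sub>R rank_one_mat v) sums (\<Sum>v\<in>B. exp (g v) *\<^sub>R rank_one_mat v)"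
    by (intro sums_sum sums_scaleR_left exp_converges)
  then show ?thesis
    unfolding mat_exp_def mat_pow_spectral_sum[OF assms]
    by (simp add: sums_iff spectral_sum_def scaleR_sum_right)
qed

text \<open>If \<open>M v = m v\<close>, then \<open>exp L v = exp m v\<close>. Expanding \<open>v\<close> in an eigenbasis of \<open>L\<close>, only
  eigenvectors whose eigenvalue \<open>l\<close> satisfies \<open>exp l = exp m\<close> occur, and real \<open>exp\<close> is
  injective, so \<open>L v = m v\<close>. This makes the matrix logarithm well defined.\<close>

lemma mat_exp_inj_symmetric:
  fixes L M :: "real^'n^'n"
  assumes "symmetric_mat L" "symmetric_mat M" and eq: "mat_exp L = mat_exp M"
  shows "L = M"
proof -
  obtain B l where B: "orthonormal_basis B" and L: "L = spectral_sum B l"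
    using symmetric_mat_spectral[OF assms(1)] .
  obtain C m where C: "orthonormal_basis C" and M: "M = spectral_sum C m"
    using symmetric_mat_spectral[OF assms(2)] .
  show ?thesis
  proof (rule matrix_eq_on_orthonormal_basis[OF C])
    fix v assume v: "v \<in> C"
    have "mat_exp L *v v = exp (m v) *\<^sub>R v"
      unfolding eq unfolding M mat_exp_spectral_sum[OF C] by (rule spectral_sum_eigenvector[OF C v])
    then have ev: "spectral_sum B (\<lambda>u. exp (l u)) *v v = exp (m v) *\<^sub>R v"
      unfolding L mat_exp_spectral_sum[OF B] .
    have "l u * (u \<bullet> v) = m v * (u \<bullet> v)" if "u \<in> B" for u
    proof -
      have "exp (l u) * (u \<bullet> v) = (spectral_sum B (\<lambda>u. exp (l u)) *v u) \<bullet> v"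
        using B that by (simp add: spectral_sum_eigenvector)
      also have "\<dots> = exp (m v) * (u \<bullet> v)"
        by (simp add: symmetric_mat_inner[OF symmetric_spectral_sum] ev)
      finally show ?thesis by simp
    qed
    then have "L *v v = (\<Sum>u\<in>B. m v *\<^sub>R ((v \<bullet> u) *\<^sub>R u))"
      unfolding L spectral_sum_vector_mult by (intro sum.cong) (auto simp: inner_commute)
    also have "\<dots> = m v *\<^sub>R v"
      by (simp only: scaleR_sum_right[symmetric] orthonormal_basis_expansion[OF B])
    also have "\<dots> = M *v v"
      using C v by (simp add: M spectral_sum_eigenvector)
    finally show "L *v v = M *v v" .
  qed
qed

lemma mat_log_spectral_sum:
  assumes "orthonormal_basis B" "\<And>v. v \<in> B \<Longrightarrow> 0 < g v"
  shows "mat_log (spectral_sum B g) = spectral_sum B (\<lambda>v. ln (g v))"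
proof -
  have "mat_exp (spectral_sum B (\<lambda>v. ln (g v))) = spectral_sum B g"
    unfolding mat_exp_spectral_sum[OF assms(1)] unfolding spectral_sum_def
    by (intro sum.cong) (simp_all add: assms(2))
  then show ?thesis
    unfolding mat_log_def
    by (intro the_equality) (auto simp: symmetric_spectral_sum intro: mat_exp_inj_symmetric)
qed

text \<open>The numbers \<open>v \<bullet> X v\<close> are nonnegative with sum \<open>tr X = 1\<close>, so \<open>tr (H X)\<close> is a convex
  combination of the eigenvalues of \<open>H\<close>, each of which is at most \<open>ln (tr (exp H))\<close>.\<close>

lemma trace_mult_le_ln_trace_exp:
  fixes H X :: "real^'n^'n"
  assumes "symmetric_mat H" "X \<in> spectraplex"
  shows "trace (H ** X) \<le> ln (trace (mat_exp H))"
proof -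
  obtain B l where B: "orthonormal_basis B" and H: "H = spectral_sum B l"
    using symmetric_mat_spectral[OF assms(1)] .
  define Z where "Z = (\<Sum>v\<in>B. exp (l v))"
  have fin: "finite B" by (rule orthonormal_basis_finite[OF B])
  have Z: "trace (mat_exp H) = Z"
    unfolding H Z_def mat_exp_spectral_sum[OF B] by (rule trace_spectral_sum[OF B])
  have "1 = trace (X ** spectral_sum B (\<lambda>_. 1))"
    using assms(2) by (simp add: spectral_sum_one[OF B] spectraplex_def)
  then have p1: "(\<Sum>v\<in>B. v \<bullet> (X *v v)) = 1"
    by (simp add: trace_mult_spectral_sum)
  have "l v \<le> ln Z" if "v \<in> B" for v
  proof -
    have "exp (l v) \<le> Z"
      unfolding Z_def using fin that by (intro member_le_sum) auto
    then show ?thesis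
      by (metis exp_gt_zero ln_exp ln_le_cancel_iff order_less_le_trans)
  qed
  moreover have "0 \<le> v \<bullet> (X *v v)" for v
    using assms(2) by (simp add: spectraplex_def psd_mat_def)
  ultimately have "(\<Sum>v\<in>B. l v * (v \<bullet> (X *v v))) \<le> (\<Sum>v\<in>B. ln Z * (v \<bullet> (X *v v)))"
    by (intro sum_mono mult_right_mono)
  also have "\<dots> = ln Z"
    by (simp add: sum_distrib_left[symmetric] p1)
  finally show ?thesis
    unfolding Z by (subst trace_mul_sym) (simp add: H trace_mult_spectral_sum)
qed

section \<open>Compactness of the moment body\<close>

text \<open>Testing positivity on \<open>e\<^sub>i \<plusminus> e\<^sub>j\<close> bounds an off-diagonal entry by the mean of two
  diagonal ones.\<close>

lemma abs_entry_le_one_of_spectraplex: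
  fixes X :: "real^'n^'n"
  assumes "X \<in> spectraplex"
  shows "\<bar>X $ i $ j\<bar> \<le> 1"
proof -
  have psd: "0 \<le> v \<bullet> (X *v v)" for v
    using assms by (simp add: spectraplex_def psd_mat_def)
  have entry: "axis p 1 \<bullet> (X *v axis q 1) = X $ p $ q" for p q
    by (simp add: matrix_vector_mult_basis inner_axis' column_def)
  have diag: "0 \<le> X $ p $ p" for p
    using psd[of "axis p 1"] by (simp add: entry)
  have X_sym: "X $ j $ i = X $ i $ j"
    using assms by (intro symmetric_mat_entry) (simp add: spectraplex_def psd_mat_def)
  have tr: "(\<Sum>p\<in>UNIV. X $ p $ p) = 1"
    using assms by (simp add: spectraplex_def trace_def)
  show ?thesis
  proof (cases "i = j")
    case True
    have "X $ i $ i \<le> (\<Sum>p\<in>UNIV. X $ p $ p)"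
      by (intro member_le_sum) (auto simp: diag)
    then show ?thesis using True diag[of i] tr by simp
  next
    case False
    have "(\<Sum>p\<in>{i, j}. X $ p $ p) \<le> (\<Sum>p\<in>UNIV. X $ p $ p)"
      by (intro sum_mono2) (auto simp: diag)
    then have le: "X $ i $ i + X $ j $ j \<le> 1"
      using False tr by simp
    have "0 \<le> X $ i $ i + 2 * X $ i $ j + X $ j $ j"
      using psd[of "axis i 1 + axis j 1"]
      by (simp add: matrix_vector_right_distrib inner_add_left inner_add_right entry X_sym)
    moreover have "0 \<le> X $ i $ i - 2 * X $ i $ j + X $ j $ j"
      using psd[of "axis i 1 - axis j 1"]
      by (simp add: matrix_vector_mult_diff_distrib inner_diff_left inner_diff_right entry X_sym)
    ultimately show ?thesis using le by linarith
  qed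
qed

lemma compact_spectraplex: "compact (spectraplex :: (real^'n^'n) set)"
proof -
  have "norm X \<le> (\<Sum>i::'n\<in>UNIV. \<Sum>j::'n\<in>UNIV. 1)" if "X \<in> spectraplex" for X :: "real^'n^'n"
  proof -
    have "norm X \<le> (\<Sum>i\<in>UNIV. norm (X $ i))"
      by (simp add: norm_vec_def L2_set_le_sum)
    also have "\<dots> \<le> (\<Sum>i\<in>UNIV. \<Sum>j\<in>UNIV. \<bar>X $ i $ j\<bar>)"
      by (intro sum_mono norm_le_l1_cart)
    also have "\<dots> \<le> (\<Sum>i::'n\<in>UNIV. \<Sum>j::'n\<in>UNIV. 1)"
      by (intro sum_mono abs_entry_le_one_of_spectraplex that)
    finally show ?thesis .
  qed
  then have "bounded (spectraplex :: (real^'n^'n) set)"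
    by (rule boundedI)
  moreover have "closed (spectraplex :: (real^'n^'n) set)"
  proof -
    have "(spectraplex :: (real^'n^'n) set)
      = {X. \<forall>i j. X $ j $ i = X $ i $ j}
        \<inter> {X. \<forall>v. 0 \<le> (\<Sum>i\<in>UNIV. v $ i * (\<Sum>j\<in>UNIV. X $ i $ j * v $ j))}
        \<inter> {X. (\<Sum>i\<in>UNIV. X $ i $ i) = 1}"
      by (auto simp: spectraplex_def psd_mat_def symmetric_mat_def trace_def transpose_def
          vec_eq_iff inner_vec_def matrix_vector_mult_def)
    also have "closed \<dots>"
      by (intro closed_Int closed_Collect_all closed_Collect_le closed_Collect_eq continuous_intros)
    finally show ?thesis .
  qed
  ultimately show ?thesis by (simp add: compact_eq_bounded_closed)
qed

lemma compact_moment_body: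
  "compact (moment_body A)"
  unfolding moment_body_def
proof (rule compact_continuous_image[OF _ compact_spectraplex])
  show "continuous_on spectraplex (moment_map A)"
    unfolding moment_map_def trace_def matrix_matrix_mult_def
    by (simp, intro continuous_on_vec_lambda continuous_intros)
qed

text \<open>A bounded set is not the whole space, so its frontier is nonempty and \<^const>\<open>infdist\<close> does
  not take its default value \<open>0\<close> for the empty set. The open ball is connected, meets \<open>S\<close> and
  misses the frontier, so it stays in \<open>S\<close>; closedness of \<open>S\<close> then adds the sphere.\<close>

lemma cball_infdist_frontier_subset:
  fixes S :: "'a::euclidean_space set"
  assumes "compact S" "b \<in> interior S" 
  shows "0 < infdist b (frontier S)" "cball b (infdist b (frontier S)) \<subseteq> S"
proof -
  let ?d = "infdist b (frontier S)"
  have bS: "b \<in> S" using assms(2) interior_subset by blast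
  have "S \<noteq> UNIV"
    using assms(1) compact_imp_bounded not_bounded_UNIV by blast
  then have "frontier S \<noteq> {}"
    using bS frontier_not_empty by blast
  then show pos: "0 < ?d"
    using assms(2) by (intro infdist_pos_not_in_closed) (auto simp: frontier_def)
  have "ball b ?d \<inter> frontier S = {}"
    using infdist_le[of _ "frontier S" b] by fastforce
  then have "ball b ?d \<subseteq> S"
    using connected_Int_frontier[OF connected_ball, of b ?d S] pos bS centre_in_ball by blast
  then show "cball b ?d \<subseteq> S"
    using closure_minimal[of "ball b ?d" S] pos assms(1) by (simp add: compact_imp_closed)
qed

section \<open>Growth and stationarity of the dual function\<close>

lemma symmetric_lin_comb:
  assumes "\<And>i. symmetric_mat (A i)"
  shows "symmetric_mat (lin_comb A y)"
proof -
  have "A k $ i $ j = A k $ j $ i" for k i j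
    by (rule symmetric_mat_entry[OF assms])
  then show ?thesis
    by (simp add: symmetric_mat_def lin_comb_def transpose_def vec_eq_iff)
qed

lemma trace_lin_comb_mult: "trace (lin_comb A y ** X) = y \<bullet> moment_map A X"
proof -
  have "trace (lin_comb A y ** X) = trace (X ** lin_comb A y)"
    by (rule trace_mul_sym)
  also have "\<dots> = (\<Sum>i\<in>UNIV. y $ i * trace (X ** A i))"
    by (simp add: lin_comb_def linear_sum[OF linear_trace_mult] linear_cmul[OF linear_trace_mult])
  also have "\<dots> = y \<bullet> moment_map A X"
    by (simp add: inner_vec_def moment_map_def trace_mul_sym[of X])
  finally show ?thesis .
qed

text \<open>The point of the ball furthest in the direction \<open>y\<close> is the moment vector of some density
  matrix, to which the bound by \<open>ln (tr (exp A(y)))\<close> applies. Using \<^const>\<open>sgn\<close> for the unit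
  vector covers \<open>y = 0\<close> as well.\<close>

lemma norm_le_dual_fun:
  fixes A :: "'m::finite \<Rightarrow> real^'n^'n"
  assumes sym: "\<And>i. symmetric_mat (A i)" and "0 \<le> \<delta>" and sub: "cball b \<delta> \<subseteq> moment_body A"
  shows "\<delta> * norm y \<le> dual_fun A b y"
proof -
  have "b + \<delta> *\<^sub>R sgn y \<in> cball b \<delta>"
    using \<open>0 \<le> \<delta>\<close> by (simp add: dist_norm norm_sgn)
  then obtain X where X: "X \<in> spectraplex" "moment_map A X = b + \<delta> *\<^sub>R sgn y"
    using sub unfolding moment_body_def by fastforce
  have "y \<bullet> sgn y = norm y"
    by (cases "y = 0") (simp_all add: sgn_div_norm dot_square_norm power2_eq_square)
  then have "trace (lin_comb A y ** X) = b \<bullet> y + \<delta> * norm y"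
    unfolding trace_lin_comb_mult X(2) by (simp add: inner_add_right inner_commute)
  then show ?thesis
    using trace_mult_le_ln_trace_exp[OF symmetric_lin_comb X(1), of A y] sym
    by (simp add: dual_fun_def)
qed

lemma lin_comb_scaleR: "lin_comb A (t *\<^sub>R y) = t *\<^sub>R lin_comb A y"
  by (simp add: lin_comb_def scaleR_sum_right)

lemma dual_fun_ray:
  assumes "orthonormal_basis B" "lin_comb A u = spectral_sum B l"
  shows "dual_fun A b (t *\<^sub>R u) = ln (\<Sum>v\<in>B. exp (t * l v)) - t * (b \<bullet> u)"
  by (simp add: dual_fun_def lin_comb_scaleR assms spectral_sum_scaleR mat_exp_spectral_sum
      trace_spectral_sum)

text \<open>In terms of the Gibbs state \<open>X\<close> at \<open>s u\<close>, this is the first-order condition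
  \<open>b \<bullet> u = tr (X A(u))\<close>, with the denominator \<open>tr (exp A(s u))\<close> cleared.\<close>

lemma dual_fun_stationary_on_ray:
  assumes B: "orthonormal_basis B" and u: "lin_comb A u = spectral_sum B l"
    and min: "\<And>t. dual_fun A b (s *\<^sub>R u) \<le> dual_fun A b (t *\<^sub>R u)"
  shows "(b \<bullet> u) * (\<Sum>v\<in>B. exp (s * l v)) = (\<Sum>v\<in>B. exp (s * l v) * l v)"
proof -
  define Z where "Z = (\<Sum>v\<in>B. exp (s * l v))"
  have Z: "0 < Z"
    unfolding Z_def
    using orthonormal_basis_finite[OF B] orthonormal_basis_nonempty[OF B] by (intro sum_pos) auto
  have "((\<lambda>t. dual_fun A b (t *\<^sub>R u)) has_real_derivative
      (\<Sum>v\<in>B. exp (s * l v) * l v) / Z - b \<bullet> u) (at s)"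
    unfolding dual_fun_ray[OF B u] using Z
    by (auto intro!: derivative_eq_intros simp: Z_def)
  then have "(\<Sum>v\<in>B. exp (s * l v) * l v) / Z - b \<bullet> u = 0"
    using min by (intro DERIV_local_min[of _ _ s 1]) auto
  then show ?thesis
    using Z by (simp add: Z_def[symmetric] field_simps)
qed

lemma dual_fun_zero: "dual_fun (A :: 'm::finite \<Rightarrow> real^'n^'n) b 0 = ln (real CARD('n))"
proof -
  obtain B :: "(real^'n) set" and l where B: "orthonormal_basis B" "lin_comb A 0 = spectral_sum B l"
    using symmetric_mat_spectral[of "lin_comb A 0"]
    by (auto simp: lin_comb_def symmetric_mat_def transpose_def vec_eq_iff)
  have "real (card B) = real CARD('n)"
    using trace_spectral_sum[OF B(1), of "\<lambda>_. 1"] by (simp add: spectral_sum_one[OF B(1)] trace_I)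
  then show ?thesis
    using dual_fun_ray[OF B, of b 0] by simp
qed

lemma trace_lin_comb_traceless:
  assumes "\<And>i. trace (A i) = 0"
  shows "trace (lin_comb A y) = 0"
  using trace_lin_comb_mult[of A y "mat 1"] assms
  by (simp add: moment_map_def inner_vec_def)

lemma ln_card_le_dual_fun_zero_moment:
  fixes A :: "'m::finite \<Rightarrow> real^'n^'n"
  assumes sym: "\<And>i. symmetric_mat (A i)" and traceless: "\<And>i. trace (A i) = 0"
  shows "ln (real CARD('n)) \<le> dual_fun A 0 y"
proof -
  obtain B l where B: "orthonormal_basis B" and l: "lin_comb A y = spectral_sum B l"
    using symmetric_mat_spectral[OF symmetric_lin_comb] sym by metis
  have "real CARD('n) = trace (mat 1 :: real^'n^'n) + trace (lin_comb A y)"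
    by (simp add: trace_I trace_lin_comb_traceless traceless)
  also have "\<dots> = (\<Sum>v\<in>B. 1 + l v)"
    using trace_spectral_sum[OF B, of "\<lambda>_. 1"] trace_spectral_sum[OF B, of l]
    by (simp add: spectral_sum_one[OF B] l sum.distrib)
  also have "\<dots> \<le> (\<Sum>v\<in>B. exp (l v))"
    by (intro sum_mono exp_ge_add_one_self)
  finally show ?thesis
    using dual_fun_ray[OF B l, of 0 1] ln_mono[of "real CARD('n)"] by simp
qed

theorem lemma11:
  fixes A :: "'m::finite \<Rightarrow> real^'n^'n"
    and b ystar :: "real^'m"
    and Xstar :: "real^'n^'n"
    and \<delta> :: real
  assumes sym: "\<And>i. symmetric_mat (A i)"
    and traceless: "\<And>i. trace (A i) = 0"
    and orthonormal: "\<And>i j. trace (A i ** A j) = (if i = j then 1 else 0)"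
    and b_int: "b \<in> interior (moment_body A)"
    and delta: "\<delta> = infdist b (frontier (moment_body A))"
    and ystar: "is_arg_min (dual_fun A b) (\<lambda>_. True) ystar"
    and Xstar: "Xstar = gibbs_state A ystar"
  shows "0 < \<delta>
    \<and> (0 \<le> dual_fun A b ystar
       \<and> dual_fun A b ystar = - trace (Xstar ** mat_log Xstar)
       \<and> - trace (Xstar ** mat_log Xstar) \<le> ln (real CARD('n))
       \<and> (dual_fun A b ystar = ln (real CARD('n)) \<longleftrightarrow> b = 0))
    \<and> (norm ystar \<le> dual_fun A b ystar / \<delta>
       \<and> dual_fun A b ystar / \<delta> \<le> ln (real CARD('n)) / \<delta>)"
proof -
  have min: "dual_fun A b ystar \<le> dual_fun A b y" for y
    using ystar by (simp add: is_arg_min_linorder)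
  have pos: "0 < \<delta>" and growth: "\<delta> * norm y \<le> dual_fun A b y" for y
    using cball_infdist_frontier_subset[OF compact_moment_body b_int]
      norm_le_dual_fun[of A \<delta> b y] sym
    by (simp_all add: delta)
  have le: "dual_fun A b ystar \<le> ln (real CARD('n))"
    using min[of 0] by (simp add: dual_fun_zero)
  have nonneg: "0 \<le> dual_fun A b ystar"
    using growth[of ystar] pos by (meson mult_nonneg_nonneg less_imp_le norm_ge_zero order_trans)
  have entropy: "dual_fun A b ystar = - trace (Xstar ** mat_log Xstar)"
  proof -
    obtain B l where B: "orthonormal_basis B" and l: "lin_comb A ystar = spectral_sum B l"
      using symmetric_mat_spectral[OF symmetric_lin_comb] sym by metis
    define Z where "Z = (\<Sum>v\<in>B. exp (l v))"
    \<comment> \<open>The eigenvalues of the Gibbs state, so that \<open>ln (p v) = l v - ln Z\<close>.\<close>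
    define p where "p v = exp (l v) / Z" for v
    have Z: "0 < Z"
      unfolding Z_def
      using orthonormal_basis_finite[OF B] orthonormal_basis_nonempty[OF B] by (intro sum_pos) auto
    have "Xstar = spectral_sum B p"
      unfolding Xstar gibbs_state_def l mat_exp_spectral_sum[OF B] trace_spectral_sum[OF B] p_def
      by (simp add: spectral_sum_scaleR Z_def[symmetric] divide_inverse mult.commute)
    then have "Xstar ** mat_log Xstar = spectral_sum B (\<lambda>v. p v * ln (p v))"
      using Z by (simp add: mat_log_spectral_sum[OF B] spectral_sum_mult[OF B] p_def)
    then have "trace (Xstar ** mat_log Xstar) = (\<Sum>v\<in>B. p v * ln (p v))"
      by (simp add: trace_spectral_sum[OF B])
    also have "\<dots> = (\<Sum>v\<in>B. exp (l v) * l v) / Z - ln Z"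
    proof -
      have "p v * ln (p v) = exp (l v) * l v / Z - ln Z / Z * exp (l v)" for v
        using Z by (simp add: p_def ln_div field_simps)
      then show ?thesis
        using Z by (simp add: sum_subtractf sum_divide_distrib[symmetric]
            sum_distrib_left[symmetric] Z_def[symmetric])
    qed
    also have "\<dots> = b \<bullet> ystar - ln Z"
      using dual_fun_stationary_on_ray[OF B l, of b 1] min Z
      by (simp add: Z_def[symmetric] field_simps)
    also have "\<dots> = - dual_fun A b ystar"
      using dual_fun_ray[OF B l, of b 1] by (simp add: Z_def)
    finally show ?thesis by simp
  qed
  have "b = 0" if eq: "dual_fun A b ystar = ln (real CARD('n))"
  proof -
    obtain B l where B: "orthonormal_basis B" and l: "lin_comb A b = spectral_sum B l"
      using symmetric_mat_spectral[OF symmetric_lin_comb] sym by metis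
    \<comment> \<open>Here \<open>f(0) = ln n\<close> is the minimum, so the line through \<open>b\<close> is stationary at \<open>0\<close>.\<close>
    have "dual_fun A b (0 *\<^sub>R b) \<le> dual_fun A b (t *\<^sub>R b)" for t
      using min[of "t *\<^sub>R b"] eq by (simp add: dual_fun_zero)
    from dual_fun_stationary_on_ray[OF B l this]
    have "(b \<bullet> b) * real (card B) = trace (lin_comb A b)"
      by (simp add: l trace_spectral_sum[OF B])
    then show ?thesis
      using orthonormal_basis_finite[OF B] orthonormal_basis_nonempty[OF B]
      by (simp add: trace_lin_comb_traceless traceless)
  qed
  moreover have "dual_fun A b ystar = ln (real CARD('n))" if "b = 0"
    using le ln_card_le_dual_fun_zero_moment[of A ystar] sym traceless that by simp
  moreover have "norm ystar \<le> dual_fun A b ystar / \<delta>"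
    using growth[of ystar] pos by (simp add: pos_le_divide_eq mult.commute)
  moreover have "dual_fun A b ystar / \<delta> \<le> ln (real CARD('n)) / \<delta>"
    using le pos by (intro divide_right_mono) auto
  ultimately show ?thesis
    using pos nonneg le entropy by metis
qed

end
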